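(* Let $n\ge 1$ and let $(p_{i,j})_{i,j\in[n]}$ be a fractional matching between $A=\{a_1,\dots,a_n\}$ and $B=\{b_1,\dots,b_n\}$. Then there exists a perfect matching $M$ between $A$ and $B$ such that for every metric $d$ on $A\cup B$, $$\sum_{(a_i,b_j)\in M} d(a_i,b_j)\ \le\ n^2\sum_{1\le i,j\le n}p_{i,j}\,d(a_i,b_j).$$ Consequently, if there is a randomized matching mechanism for $n$ agents and $n$ items that guarantees distortion $D$, then there is a deterministic matching mechanism for $n$ agents and $n$ items that guarantees distortion $Dn^2$.
   Context: A metric is a function $d:(A\cup B)\times(A\cup B)\to\mathbb{R}_{\ge 0}$ with $d(x,x)=0$, $d(x,y)=d(y,x)$ and $d(x,y)\le d(x,z)+d(z,y)$ (distinct points are allowed to be at distance $0$). A fractional matching is a family of nonnegative reals $p_{i,j}$ with $\sum_i p_{i,j}=1$ for all $j$ and $\sum_j p_{i,j}=1$ for all $i$. A perfect matching is a bijection $M:A\to B$, also regarded as the set of pairs $(a,M(a))$. The elements of $A$ are agents and those of $B$ are items. An ordinal matching problem instance consists of $n$ preference lists, one per agent; each list is a permutation of $B$. A metric $d$ is consistent with the instance if, for every agent $a_i$, whenever $b_j$ appears before $b_k$ in the list of $a_i$ we have $d(a_i,b_j)\le d(a_i,b_k)$. A deterministic mechanism maps each instance (preference lists only) to a perfect matching $M$, with $\mathrm{cost}_d(M)=\sum_i d(a_i,M(a_i))$; a randomized mechanism maps each instance to a distribution over perfect matchings, equivalently for cost purposes to a fractional matching $(p_{i,j})$ ($p_{i,j}$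 the probability that $a_i$ is matched to $b_j$), with (expected) cost $\sum_{i,j}p_{i,j}d(a_i,b_j)$. A mechanism guarantees distortion $D$ if, for every instance and every metric $d$ consistent with it, the (expected) cost of its output is at most $D\cdot\mathrm{cost}_d(M_{\mathrm{OPT}})$, where $M_{\mathrm{OPT}}$ is a minimum-cost perfect matching with respect to $d$. *)

theory Defs
  imports
    "HOL-Probability.Probability"
    "HOL-Combinatorics.Multiset_Permutations"
begin

(* Distinct points may be at distance 0, which Metric_space and the class metric_space exclude. *)
definition metric_on :: "'v set \<Rightarrow> ('v \<Rightarrow> 'v \<Rightarrow> real) \<Rightarrow> bool" where
  "metric_on S d \<longleftrightarrow>
     (\<forall>x\<in>S. \<forall>y\<in>S. 0 \<le> d x y) \<and>
     (\<forall>x\<in>S. d x x = 0) \<and>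
     (\<forall>x\<in>S. \<forall>y\<in>S. d x y = d y x) \<and>
     (\<forall>x\<in>S. \<forall>y\<in>S. \<forall>z\<in>S. d x y \<le> d x z + d z y)"

definition fractional_matching :: "'v set \<Rightarrow> 'v set \<Rightarrow> ('v \<Rightarrow> 'v \<Rightarrow> real) \<Rightarrow> bool" where
  "fractional_matching A B p \<longleftrightarrow>
     (\<forall>a\<in>A. \<forall>b\<in>B. 0 \<le> p a b) \<and>
     (\<forall>b\<in>B. (\<Sum>a\<in>A. p a b) = 1) \<and>
     (\<forall>a\<in>A. (\<Sum>b\<in>B. p a b) = 1)"

(* Matchings are extensional on A, so each bijection from A to B is represented by exactly one
   function and the set of perfect matchings is finite. *)
definition perfect_matchings :: "'v set \<Rightarrow> 'v set \<Rightarrow> ('v \<Rightarrow> 'v) set" where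
  "perfect_matchings A B = {M \<in> extensional A. bij_betw M A B}"

definition matching_cost :: "'v set \<Rightarrow> ('v \<Rightarrow> 'v \<Rightarrow> real) \<Rightarrow> ('v \<Rightarrow> 'v) \<Rightarrow> real" where
  "matching_cost A d M = (\<Sum>a\<in>A. d a (M a))"

definition fractional_cost ::
    "'v set \<Rightarrow> 'v set \<Rightarrow> ('v \<Rightarrow> 'v \<Rightarrow> real) \<Rightarrow> ('v \<Rightarrow> 'v \<Rightarrow> real) \<Rightarrow> real" where
  "fractional_cost A B d p = (\<Sum>a\<in>A. \<Sum>b\<in>B. p a b * d a b)"

definition min_cost_matching ::
    "'v set \<Rightarrow> 'v set \<Rightarrow> ('v \<Rightarrow> 'v \<Rightarrow> real) \<Rightarrow> ('v \<Rightarrow> 'v) \<Rightarrow> bool" where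
  "min_cost_matching A B d M \<longleftrightarrow>
     is_arg_min (matching_cost A d) (\<lambda>M'. M' \<in> perfect_matchings A B) M"

definition ordinal_instances :: "'v set \<Rightarrow> 'v set \<Rightarrow> ('v \<Rightarrow> 'v list) set" where
  "ordinal_instances A B = A \<rightarrow>\<^sub>E permutations_of_set B"

definition consistent ::
    "'v set \<Rightarrow> ('v \<Rightarrow> 'v list) \<Rightarrow> ('v \<Rightarrow> 'v \<Rightarrow> real) \<Rightarrow> bool" where
  "consistent A L d \<longleftrightarrow>
     (\<forall>a\<in>A. \<forall>j k. j < k \<and> k < length (L a) \<longrightarrow> d a (L a ! j) \<le> d a (L a ! k))"

(* A mechanism is a function of the preference lists alone; its values outside
   ordinal_instances A B are irrelevant. *)
definition deterministic_mechanism ::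
    "'v set \<Rightarrow> 'v set \<Rightarrow> (('v \<Rightarrow> 'v list) \<Rightarrow> 'v \<Rightarrow> 'v) \<Rightarrow> bool" where
  "deterministic_mechanism A B F \<longleftrightarrow>
     (\<forall>L\<in>ordinal_instances A B. F L \<in> perfect_matchings A B)"

definition randomized_mechanism ::
    "'v set \<Rightarrow> 'v set \<Rightarrow> (('v \<Rightarrow> 'v list) \<Rightarrow> ('v \<Rightarrow> 'v) pmf) \<Rightarrow> bool" where
  "randomized_mechanism A B R \<longleftrightarrow>
     (\<forall>L\<in>ordinal_instances A B. set_pmf (R L) \<subseteq> perfect_matchings A B)"

definition deterministic_distortion ::
    "'v set \<Rightarrow> 'v set \<Rightarrow> (('v \<Rightarrow> 'v list) \<Rightarrow> 'v \<Rightarrow> 'v) \<Rightarrow> real \<Rightarrow> bool" where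
  "deterministic_distortion A B F D \<longleftrightarrow>
     (\<forall>L\<in>ordinal_instances A B. \<forall>d M_opt.
        metric_on (A \<union> B) d \<and> consistent A L d \<and> min_cost_matching A B d M_opt \<longrightarrow>
        matching_cost A d (F L) \<le> D * matching_cost A d M_opt)"

definition randomized_distortion ::
    "'v set \<Rightarrow> 'v set \<Rightarrow> (('v \<Rightarrow> 'v list) \<Rightarrow> ('v \<Rightarrow> 'v) pmf) \<Rightarrow> real \<Rightarrow> bool" where
  "randomized_distortion A B R D \<longleftrightarrow>
     (\<forall>L\<in>ordinal_instances A B. \<forall>d M_opt.
        metric_on (A \<union> B) d \<and> consistent A L d \<and> min_cost_matching A B d M_opt \<longrightarrow>
        measure_pmf.expectation (R L) (matching_cost A d) \<le> D * matching_cost A d M_opt)"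

end

theory Submission
  imports Defs
begin

text \<open>
  The pairs with \<open>p a b \<ge> 1 / n\<^sup>2\<close> satisfy Hall's condition: if \<open>X \<subseteq> A\<close> had a neighbourhood \<open>Y\<close>
  with \<open>card Y < card X\<close>, then \<open>p\<close> would send mass at least \<open>1\<close> from \<open>X\<close> to \<open>B - Y\<close>, spread over at
  most \<open>n\<^sup>2\<close> pairs each carrying less than \<open>1 / n\<^sup>2\<close>. A matching \<open>M\<close> inside these pairs satisfies
  \<open>d a (M a) \<le> n\<^sup>2 * p a (M a) * d a (M a)\<close> for every nonnegative \<open>d\<close>.
\<close>

section \<open>Hall's marriage theorem\<close>

theorem hall_marriage:
  fixes N :: "'a \<Rightarrow> 'b set"
  assumes "finite A" and "\<And>a. a \<in> A \<Longrightarrow> finite (N a)"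
    and "\<And>X. X \<subseteq> A \<Longrightarrow> card X \<le> card (\<Union> (N ` X))"
  shows "\<exists>f. inj_on f A \<and> (\<forall>a\<in>A. f a \<in> N a)"
  using assms
proof (induction "card A" arbitrary: A N rule: less_induct)
  case less
  note fin = less.prems(1) and finN = less.prems(2) and hall = less.prems(3)
  have fin_sub: "finite X" if "X \<subseteq> A" for X
    using fin that finite_subset by blast
  \<comment> \<open>The Halmos-Vaughan split: if some nonempty proper subset \<open>S\<close> is
    tight, then \<open>S\<close> and \<open>A - S\<close> are matched separately. Otherwise every
    such subset has a neighbour to spare, and one arbitrary pair can be fixed first.\<close>
  show ?case
  proof (cases "\<exists>S. S \<subset> A \<and> S \<noteq> {} \<and> card (\<Union> (N ` S)) \<le> card S")
    case True
    then obtain S where S: "S \<subset> A" "S \<noteq> {}" "card (\<Union> (N ` S)) \<le> card S"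
      by blast
    define T where "T = \<Union> (N ` S)"
    have "\<exists>f. inj_on f S \<and> (\<forall>a\<in>S. f a \<in> N a)"
    proof (rule less.hyps)
      show "card S < card A"
        using S fin by (simp add: psubset_card_mono)
    qed (use S fin_sub finN hall in auto)
    then obtain f where f: "inj_on f S" "\<forall>a\<in>S. f a \<in> N a"
      by blast
    have "\<exists>g. inj_on g (A - S) \<and> (\<forall>a\<in>A - S. g a \<in> N a - T)"
    proof (rule less.hyps)
      have "S \<inter> A \<noteq> {}"
        using S by blast
      then show "card (A - S) < card A"
        using fin S by (intro psubset_card_mono) auto
      \<comment> \<open>All neighbours of \<open>S\<close> are withheld from \<open>A - S\<close>.
        Hall's condition for \<open>X \<union> S\<close>, minus the at most \<open>card S\<close>
        elements of \<open>T\<close>, leaves enough for \<open>X\<close>.\<close>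
      show "card X \<le> card (\<Union>a\<in>X. N a - T)" if X: "X \<subseteq> A - S" for X
      proof -
        have "card X + card S = card (X \<union> S)"
          using X S fin_sub[of X] fin_sub[of S] by (subst card_Un_disjoint) auto
        also have "\<dots> \<le> card (\<Union> (N ` (X \<union> S)))"
          using X S by (intro hall) auto
        also have "\<Union> (N ` (X \<union> S)) = (\<Union>a\<in>X. N a - T) \<union> T"
          by (auto simp: T_def)
        also have "card \<dots> \<le> card (\<Union>a\<in>X. N a - T) + card T"
          by (rule card_Un_le)
        finally show ?thesis
          using S by (simp add: T_def)
      qed
    qed (use fin finN in auto)
    then obtain g where g: "inj_on g (A - S)" "\<forall>a\<in>A - S. g a \<in> N a - T"
      by blast
    have "f ` S \<inter> g ` (A - S) = {}"
      using f(2) g(2) by (fastforce simp: T_def)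
    with f(1) g(1) have "inj_on (\<lambda>a. if a \<in> S then f a else g a) (S \<union> (A - S))"
      by (rule inj_on_disjoint_Un)
    moreover have "S \<union> (A - S) = A"
      using S by blast
    ultimately have "inj_on (\<lambda>a. if a \<in> S then f a else g a) A"
      by (simp only:)
    moreover have "\<forall>a\<in>A. (if a \<in> S then f a else g a) \<in> N a"
      using f(2) g(2) by simp
    ultimately show ?thesis
      by (intro exI conjI)
  next
    case no_tight: False
    show ?thesis
    proof (cases "A = {}")
      case True
      then show ?thesis by simp
    next
      case False
      then obtain a where a: "a \<in> A"
        by blast
      have "card {a} \<le> card (\<Union> (N ` {a}))"
        using a by (intro hall) auto
      then obtain b where b: "b \<in> N a"
        by (cases "N a = {}") auto
      have "\<exists>g. inj_on g (A - {a}) \<and> (\<forall>x\<in>A - {a}. g x \<in> N x - {b})"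
      proof (rule less.hyps)
        show "card (A - {a}) < card A"
          using fin a by (rule card_Diff1_less)
        \<comment> \<open>A nonempty \<open>X\<close> is a proper subset of \<open>A\<close> because
          it misses \<open>a\<close>, so it is not tight; its surplus neighbour pays for the loss of
          \<open>b\<close>.\<close>
        show "card X \<le> card (\<Union>x\<in>X. N x - {b})" if X: "X \<subseteq> A - {a}" for X
        proof (cases "X = {}")
          case False
          have "X \<subset> A"
            using X a by blast
          with no_tight False
          have "card X < card (\<Union> (N ` X))"
            by (meson not_le)
          moreover have "card (\<Union> (N ` X)) - 1 \<le> card (\<Union> (N ` X) - {b})"
            by (simp add: card_Diff_singleton_if)
          ultimately have "card X \<le> card (\<Union> (N ` X) - {b})"
            by linarith
          also have "\<Union> (N ` X) - {b} = (\<Union>x\<in>X. N x - {b})"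
            by blast
          finally show ?thesis .
        qed simp
      qed (use fin finN in auto)
      then obtain g where g: "inj_on g (A - {a})" "\<forall>x\<in>A - {a}. g x \<in> N x - {b}"
        by blast
      have "b \<notin> g ` (A - {a})"
        using g(2) by auto
      then have "inj_on (g(a := b)) (insert a (A - {a}))"
        using inj_on_fun_updI[OF g(1)] by (simp only: inj_on_insert) simp
      then have "inj_on (g(a := b)) A"
        using a by (simp only: insert_Diff)
      moreover have "\<forall>x\<in>A. (g(a := b)) x \<in> N x"
        using g(2) b by auto
      ultimately show ?thesis
        by (intro exI conjI)
    qed
  qed
qed

section \<open>Rounding a fractional matching\<close>

lemma perfect_matching_of_inj_on:
  assumes "finite B" and "card A = card B" and "inj_on f A" and "f ` A \<subseteq> B"
  shows "restrict f A \<in> perfect_matchings A B"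
proof -
  have "f ` A = B"
    using assms by (intro card_subset_eq) (auto simp: card_image)
  then show ?thesis
    using assms by (auto simp: perfect_matchings_def bij_betw_def)
qed

lemma fractional_matching_heavy_perfect_matching:
  assumes A: "finite A" "card A = n" and B: "finite B" "card B = n"
    and p: "fractional_matching A B p"
  shows "\<exists>M\<in>perfect_matchings A B. \<forall>a\<in>A. 1 \<le> (real n)\<^sup>2 * p a (M a)"
proof -
  have p_nonneg: "0 \<le> p a b" if "a \<in> A" "b \<in> B" for a b
    using p that by (auto simp: fractional_matching_def)
  have col: "(\<Sum>a\<in>A. p a b) = 1" if "b \<in> B" for b
    using p that by (auto simp: fractional_matching_def)
  have row: "(\<Sum>b\<in>B. p a b) = 1" if "a \<in> A" for a
    using p that by (auto simp: fractional_matching_def)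
  \<comment> \<open>The threshold \<open>1 / n\<^sup>2\<close> with its denominator cleared;
    \<open>n\<^sup>2\<close> bounds the number of pairs in \<open>X \<times> (B - Y)\<close>
    below.\<close>
  define N where "N a = {b \<in> B. 1 \<le> (real n)\<^sup>2 * p a b}" for a
  have "\<exists>f. inj_on f A \<and> (\<forall>a\<in>A. f a \<in> N a)"
  proof (rule hall_marriage)
    fix X assume X: "X \<subseteq> A"
    define Y where "Y = \<Union> (N ` X)"
    have Y: "Y \<subseteq> B"
      by (auto simp: Y_def N_def)
    have finX: "finite X"
      using X A finite_subset by blast
    show "card X \<le> card (\<Union> (N ` X))"
    proof (rule ccontr)
      assume "\<not> ?thesis"
      then have less: "card Y < card X"
        by (simp add: Y_def)
      \<comment> \<open>Double counting: the rows of \<open>X\<close> carry mass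
        \<open>card X\<close>, and by the column sums at most \<open>card Y\<close> of it lands in
        \<open>Y\<close>. Both cardinalities are integers, so the strict inequality leaves at least
        1 for \<open>B - Y\<close>.\<close>
      have "real (card X) = (\<Sum>a\<in>X. \<Sum>b\<in>B. p a b)"
        using X row by (simp add: subset_iff)
      also have "\<dots> = (\<Sum>a\<in>X. \<Sum>b\<in>Y. p a b) + (\<Sum>a\<in>X. \<Sum>b\<in>B - Y. p a b)"
        using Y B by (simp add: sum.subset_diff[of Y B] sum.distrib)
      also have "(\<Sum>a\<in>X. \<Sum>b\<in>Y. p a b) = (\<Sum>b\<in>Y. \<Sum>a\<in>X. p a b)"
        by (rule sum.swap)
      also have "\<dots> \<le> (\<Sum>b\<in>Y. \<Sum>a\<in>A. p a b)"
        using X Y A p_nonneg by (intro sum_mono sum_mono2) auto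
      also have "\<dots> = real (card Y)"
        using Y col by (simp add: subset_iff)
      finally have "1 \<le> (\<Sum>a\<in>X. \<Sum>b\<in>B - Y. p a b)"
        using less by linarith
      then have "(real n)\<^sup>2 \<le> (\<Sum>(a, b)\<in>X \<times> (B - Y). (real n)\<^sup>2 * p a b)"
        by (simp add: sum.cartesian_product[symmetric] sum_distrib_left[symmetric]
            mult_le_cancel_left1)
      \<comment> \<open>\<open>Y\<close> contains every \<open>N a\<close> with
        \<open>a \<in> X\<close>, so each term on the left is below 1. Strictness needs a nonempty
        index set, and an empty one could not carry mass 1.\<close>
      also have "\<dots> < (\<Sum>(a, b)\<in>X \<times> (B - Y). 1)"
      proof (rule sum_strict_mono)
        show "X \<times> (B - Y) \<noteq> {}"
        proof
          assume "X \<times> (B - Y) = {}"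
          then have "(\<Sum>a\<in>X. \<Sum>b\<in>B - Y. p a b) = 0"
            unfolding sum.cartesian_product by (simp only: sum.empty)
          with \<open>1 \<le> (\<Sum>a\<in>X. \<Sum>b\<in>B - Y. p a b)\<close> show False
            by simp
        qed
      qed (use finX B in \<open>auto simp: Y_def N_def not_le\<close>)
      also have "\<dots> = real (card X * card (B - Y))"
        by (simp add: case_prod_beta card_cartesian_product)
      also have "\<dots> \<le> real (n * n)"
        using X A B card_mono[of A X] card_mono[of B "B - Y"]
        by (intro of_nat_mono mult_le_mono) auto
      finally show False
        by (simp add: power2_eq_square)
    qed
  qed (use A B in \<open>auto simp: N_def\<close>)
  then obtain f where f: "inj_on f A" "\<forall>a\<in>A. f a \<in> N a"
    by blast
  have "restrict f A \<in> perfect_matchings A B"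
    using A B f by (intro perfect_matching_of_inj_on) (auto simp: N_def)
  moreover have "\<forall>a\<in>A. 1 \<le> (real n)\<^sup>2 * p a (restrict f A a)"
    using f by (auto simp: N_def)
  ultimately show ?thesis
    by blast
qed

text \<open>Each \<open>d a (M a)\<close> is charged to the single term
  \<open>p a (M a) * d a (M a)\<close> in the row of \<open>a\<close>. The order of quantifiers is
  essential: \<open>M\<close> comes from \<open>p\<close> alone, as a mechanism must choose it
  without seeing \<open>d\<close>.\<close>

lemma perfect_matching_cost_le_fractional_cost:
  assumes A: "finite A" "card A = n" and B: "finite B" "card B = n"
    and p: "fractional_matching A B p"
  shows "\<exists>M\<in>perfect_matchings A B. \<forall>d. (\<forall>a\<in>A. \<forall>b\<in>B. 0 \<le> d a b) \<longrightarrow>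
           matching_cost A d M \<le> (real n)\<^sup>2 * fractional_cost A B d p"
proof -
  from fractional_matching_heavy_perfect_matching[OF assms]
  obtain M where M: "M \<in> perfect_matchings A B"
    and heavy: "\<And>a. a \<in> A \<Longrightarrow> 1 \<le> (real n)\<^sup>2 * p a (M a)"
    by blast
  have MB: "M a \<in> B" if "a \<in> A" for a
    using M that by (auto simp: perfect_matchings_def bij_betw_def)
  have "matching_cost A d M \<le> (real n)\<^sup>2 * fractional_cost A B d p"
    if d: "\<forall>a\<in>A. \<forall>b\<in>B. 0 \<le> d a b" for d
  proof -
    have "d a (M a) \<le> (real n)\<^sup>2 * (\<Sum>b\<in>B. p a b * d a b)" if a: "a \<in> A" for a
    proof -
      have "1 * d a (M a) \<le> (real n)\<^sup>2 * p a (M a) * d a (M a)"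
        using a MB d heavy by (intro mult_right_mono) auto
      also have "\<dots> = (real n)\<^sup>2 * (p a (M a) * d a (M a))"
        by (rule mult.assoc)
      also have "p a (M a) * d a (M a) \<le> (\<Sum>b\<in>B. p a b * d a b)"
      proof (rule member_le_sum[where f = "\<lambda>b. p a b * d a b"])
        show "0 \<le> p a b * d a b" if "b \<in> B - {M a}" for b
          using a d p that by (intro mult_nonneg_nonneg) (auto simp: fractional_matching_def)
      qed (use a MB B in auto)
      finally show ?thesis
        by (simp add: mult_left_mono)
    qed
    then show ?thesis
      unfolding matching_cost_def fractional_cost_def sum_distrib_left[of _ _ A]
      by (rule sum_mono)
  qed
  with M show ?thesis
    by blast
qed

section \<open>From random matchings to fractional ones\<close>

lemma finite_perfect_matchings:
  assumes "finite A" and "finite B"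
  shows "finite (perfect_matchings A B)"
proof (rule finite_subset)
  show "perfect_matchings A B \<subseteq> A \<rightarrow>\<^sub>E B"
    by (auto simp: perfect_matchings_def bij_betw_def PiE_def)
qed (use assms in \<open>auto intro: finite_PiE\<close>)

text \<open>\<open>p a b\<close> is the probability that the drawn matching sends \<open>a\<close>
  to \<open>b\<close>. Every matching in the support has row and column sums 1, and averaging
  preserves this; the cost identity is linearity of expectation.\<close>

lemma fractional_matching_of_pmf:
  fixes P :: "('v \<Rightarrow> 'v) pmf"
  assumes A: "finite A" and B: "finite B" and P: "set_pmf P \<subseteq> perfect_matchings A B"
  defines "p \<equiv> \<lambda>a b. \<Sum>M\<in>perfect_matchings A B. pmf P M * of_bool (M a = b)"
  shows "fractional_matching A B p"
    and "fractional_cost A B d p = measure_pmf.expectation P (matching_cost A d)"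
proof -
  let ?S = "perfect_matchings A B"
  have fin: "finite ?S"
    using A B by (rule finite_perfect_matchings)
  have total: "(\<Sum>M\<in>?S. pmf P M) = 1"
    using fin P by (rule sum_pmf_eq_1)
  have bij: "bij_betw M A B" if "M \<in> ?S" for M
    using that by (simp add: perfect_matchings_def)
  \<comment> \<open>The weight \<open>g\<close> serves two purposes: the constant 1 yields the row
    sums, and \<open>d a\<close> yields the cost.\<close>
  have at_image: "(\<Sum>b\<in>B. of_bool (M a = b) * g b) = g (M a)"
    if "M \<in> ?S" "a \<in> A" for M a and g :: "'v \<Rightarrow> real"
  proof -
    have "(\<Sum>b\<in>B. of_bool (M a = b) * g b) = (\<Sum>b\<in>B. if M a = b then g b else 0)"
      by (intro sum.cong) auto
    then show ?thesis
      using bij_betwE[OF bij[OF that(1)]] that(2) B by simp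
  qed
  have preimage: "(\<Sum>a\<in>A. of_bool (M a = b)) = (1 :: real)" if "M \<in> ?S" "b \<in> B" for M b
  proof -
    \<comment> \<open>Reindexing along the bijection \<open>M\<close> turns counting the preimages
      of \<open>b\<close> into counting \<open>b\<close> itself in \<open>B\<close>.\<close>
    have "(\<Sum>a\<in>A. of_bool (M a = b)) = (\<Sum>b'\<in>B. of_bool (b' = b) :: real)"
      using bij[OF that(1)] by (rule sum.reindex_bij_betw)
    then show ?thesis
      using that(2) B by (simp add: of_bool_def)
  qed
  have "(\<Sum>a\<in>A. p a b) = 1" if "b \<in> B" for b
  proof -
    have "(\<Sum>a\<in>A. p a b) = (\<Sum>M\<in>?S. pmf P M * (\<Sum>a\<in>A. of_bool (M a = b)))"
      unfolding p_def by (subst sum.swap) (simp only: sum_distrib_left)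
    also have "\<dots> = (\<Sum>M\<in>?S. pmf P M)"
      using that preimage by simp
    finally show ?thesis
      using total by simp
  qed
  moreover have "(\<Sum>b\<in>B. p a b) = 1" if "a \<in> A" for a
  proof -
    have "(\<Sum>b\<in>B. p a b) = (\<Sum>M\<in>?S. pmf P M * (\<Sum>b\<in>B. of_bool (M a = b) * 1))"
      unfolding p_def by (subst sum.swap) (simp only: sum_distrib_left mult_1_right)
    also have "\<dots> = (\<Sum>M\<in>?S. pmf P M)"
      using that at_image[of _ a "\<lambda>_. 1"] by simp
    finally show ?thesis
      using total by simp
  qed
  ultimately show "fractional_matching A B p"
    by (auto simp: fractional_matching_def p_def intro!: sum_nonneg)
  have "fractional_cost A B d p
      = (\<Sum>a\<in>A. \<Sum>M\<in>?S. pmf P M * (\<Sum>b\<in>B. of_bool (M a = b) * d a b))"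
    unfolding fractional_cost_def p_def sum_distrib_right sum_distrib_left mult.assoc
    by (intro sum.cong refl sum.swap)
  also have "\<dots> = (\<Sum>a\<in>A. \<Sum>M\<in>?S. pmf P M * d a (M a))"
    using at_image by simp
  also have "\<dots> = (\<Sum>M\<in>?S. pmf P M * matching_cost A d M)"
    unfolding matching_cost_def by (subst sum.swap) (simp only: sum_distrib_left)
  also have "\<dots> = measure_pmf.expectation P (matching_cost A d)"
    using fin P by (subst integral_measure_pmf_real[of ?S]) (auto simp: mult.commute)
  finally show "fractional_cost A B d p = measure_pmf.expectation P (matching_cost A d)" .
qed

section \<open>Derandomizing mechanisms\<close>

theorem mainTheorem5:
  fixes A B :: "'v set" and n :: nat
  assumes "n \<ge> 1"
    and "finite A" and "card A = n"
    and "finite B" and "card B = n"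
    and "A \<inter> B = {}"
  shows "(\<forall>p. fractional_matching A B p \<longrightarrow>
            (\<exists>M\<in>perfect_matchings A B. \<forall>d. metric_on (A \<union> B) d \<longrightarrow>
               matching_cost A d M \<le> (real n)\<^sup>2 * fractional_cost A B d p))
       \<and> (\<forall>D. (\<exists>R. randomized_mechanism A B R \<and> randomized_distortion A B R D) \<longrightarrow>
               (\<exists>F. deterministic_mechanism A B F \<and>
                    deterministic_distortion A B F (D * (real n)\<^sup>2)))"
proof -
  have nonneg: "\<forall>a\<in>A. \<forall>b\<in>B. 0 \<le> d a b" if "metric_on (A \<union> B) d" for d
    using that by (auto simp: metric_on_def)
  show ?thesis
  proof (intro conjI allI impI)
    fix p assume "fractional_matching A B p"
    with assms show "\<exists>M\<in>perfect_matchings A B. \<forall>d. metric_on (A \<union> B) d \<longrightarrow>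
        matching_cost A d M \<le> (real n)\<^sup>2 * fractional_cost A B d p"
      using perfect_matching_cost_le_fractional_cost[of A n B p] nonneg by blast
  next
    fix D assume "\<exists>R. randomized_mechanism A B R \<and> randomized_distortion A B R D"
    then obtain R where R: "randomized_mechanism A B R" "randomized_distortion A B R D"
      by blast
    \<comment> \<open>The rounding bound, applied to the marginals of \<open>R L\<close>.\<close>
    have "\<exists>M\<in>perfect_matchings A B. \<forall>d. metric_on (A \<union> B) d \<longrightarrow>
        matching_cost A d M \<le> (real n)\<^sup>2 * measure_pmf.expectation (R L) (matching_cost A d)"
      if L: "L \<in> ordinal_instances A B" for L
    proof -
      have supp: "set_pmf (R L) \<subseteq> perfect_matchings A B"
        using R(1) L by (simp add: randomized_mechanism_def)
      define p where
        "p = (\<lambda>a b. \<Sum>M\<in>perfect_matchings A B. pmf (R L) M * of_bool (M a = b))"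
      have p: "fractional_matching A B p"
        unfolding p_def using \<open>finite A\<close> \<open>finite B\<close> supp by (rule fractional_matching_of_pmf)
      have cost: "fractional_cost A B d p
          = measure_pmf.expectation (R L) (matching_cost A d)" for d
        unfolding p_def using \<open>finite A\<close> \<open>finite B\<close> supp by (rule fractional_matching_of_pmf)
      show ?thesis
        using perfect_matching_cost_le_fractional_cost[OF assms(2-5) p] nonneg
        unfolding cost by blast
    qed
    \<comment> \<open>For each \<open>L\<close> one matching works for all metrics at once, so
      choosing one per instance gives a function of the preference lists only.\<close>
    then obtain F where F: "\<And>L. L \<in> ordinal_instances A B \<Longrightarrow> F L \<in> perfect_matchings A B"
      and F_cost: "\<And>L d. L \<in> ordinal_instances A B \<Longrightarrow> metric_on (A \<union> B) d \<Longrightarrow>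
        matching_cost A d (F L) \<le> (real n)\<^sup>2 * measure_pmf.expectation (R L) (matching_cost A d)"
      by metis
    have "deterministic_mechanism A B F"
      using F by (simp add: deterministic_mechanism_def)
    moreover have "deterministic_distortion A B F (D * (real n)\<^sup>2)"
      unfolding deterministic_distortion_def
    proof (intro ballI allI impI)
      fix L d M_opt
      assume L: "L \<in> ordinal_instances A B"
        and H: "metric_on (A \<union> B) d \<and> consistent A L d \<and> min_cost_matching A B d M_opt"
      have "matching_cost A d (F L)
          \<le> (real n)\<^sup>2 * measure_pmf.expectation (R L) (matching_cost A d)"
        using F_cost L H by blast
      also have "\<dots> \<le> (real n)\<^sup>2 * (D * matching_cost A d M_opt)"
        using R(2) L H by (intro mult_left_mono) (auto simp: randomized_distortion_def)
      finally show "matching_cost A d (F L) \<le> D * (real n)\<^sup>2 * matching_cost A d M_opt"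
        by (simp add: mult_ac)
    qed
    ultimately show "\<exists>F. deterministic_mechanism A B F \<and>
        deterministic_distortion A B F (D * (real n)\<^sup>2)"
      by blast
  qed
qed

end
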